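(* Let $\sigma$ be a propositional signature and $\mathbf{p}\subseteq\sigma$. For any classical propositional formula $F$ of $\sigma$ and any classical propositional interpretation $I$ of $\sigma$, $I$ is a (Boolean) stable model of $F$ relative to $\mathbf{p}$ if and only if $I^{\mathit{fuzzy}}$ is a (fuzzy) stable model of $F^{\mathit{fuzzy}}$ relative to $\mathbf{p}$.
   Context: Classical side. Propositional formulas of $\sigma$ are built from atoms in $\sigma$ with the primitive connectives $\bot,\top,\neg,\land,\lor,\rightarrow$. An interpretation (a function $\sigma\to\{\mathrm{false},\mathrm{true}\}$) is identified with the set of atoms true in it. The reduct $F^X$ of $F$ relative to $X$ is: for $F$ an atom, $\bot$ or $\top$, $F^X=F$ if $X\models F$ and $\bot$ otherwise; $(\neg F)^X=\bot$ if $X\models F$ and $\top$ otherwise; for $\odot\in\{\land,\lor,\rightarrow\}$, $(F\odot G)^X=F^X\odot G^X$ if $X\models F\odot G$ and $\bot$ otherwise. $X$ is a (Boolean) stable model of $F$ relative to $\mathbf{p}$ if $X\models F$ and there is no proper subset $Y\subsetneq X$ with $X\setminus Y\subseteq\mathbf{p}$ and $Y\models F^X$. Fuzzy side. Fuzzy formulas of $\sigma$ are built from atoms of $\sigma$ and numeric constants $c\in[0,1]$ using fuzzy operators; those used here are $\neg_s(x)=1-x$, $\otimes_m(x,y)=\min(x,y)$, $\oplus_m(x,y)=\max(x,y)$, $\rightarrow_s\!(x,y)=\max(1-x,y)$. A fuzzy interpretation is a map $I:\sigma\to[0,1]$; its truth value function is $\upsilon_I(p)=I(p)$, $\upsilon_I(c)=c$,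 $\upsilon_I(\neg F)=\neg(\upsilon_I(F))$, $\upsilon_I(F\odot G)=\odot(\upsilon_I(F),\upsilon_I(G))$ for binary operators $\odot$; $I\models F$ means $\upsilon_I(F)=1$. The fuzzy reduct: $F^I=F$ for $F$ an atom or numeric constant; $(\neg F)^I=\upsilon_I(\neg F)$ (a numeric constant); $(F\odot G)^I=(F^I\odot G^I)\otimes_m\upsilon_I(F\odot G)$ for every binary $\odot$. $J<^{\mathbf{p}}I$ means $J\neq I$, $J(p)=I(p)$ for all $p\notin\mathbf{p}$, and $J(p)\le I(p)$ for all $p\in\mathbf{p}$. $I$ is a (fuzzy) stable model of $F$ relative to $\mathbf{p}$ if $I\models F$ and no fuzzy interpretation $J<^{\mathbf{p}}I$ satisfies $J\models F^I$. Translation. $F^{\mathit{fuzzy}}$ is obtained from $F$ by replacing $\bot$ with $0$, $\top$ with $1$, $\neg$ with $\neg_s$, $\land$ with $\otimes_m$, $\lor$ with $\oplus_m$, and $\rightarrow$ with $\rightarrow_s$. $I^{\mathit{fuzzy}}(p)=1$ if $I(p)=\mathrm{true}$ and $I^{\mathit{fuzzy}}(p)=0$ otherwise. *)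

theory Defs
  imports Complex_Main "HOL-Library.FuncSet"
begin

datatype (atoms: 'a) form =
    Atom 'a
  | Bot
  | Top
  | Neg "'a form"
  | And "'a form" "'a form"
  | Or "'a form" "'a form"
  | Imp "'a form" "'a form"

text \<open>
  A signature is a set \<open>\<sigma>\<close> of atoms, and \<open>F\<close> is a formula of \<open>\<sigma>\<close> iff \<open>atoms F \<subseteq> \<sigma>\<close>.
  A classical interpretation of \<open>\<sigma>\<close> is identified with the set \<open>X \<subseteq> \<sigma>\<close> of the atoms true in it.
\<close>

primrec sat :: "'a set \<Rightarrow> 'a form \<Rightarrow> bool" where
  "sat X (Atom a) \<longleftrightarrow> a \<in> X"
| "sat X Bot \<longleftrightarrow> False"
| "sat X Top \<longleftrightarrow> True"
| "sat X (Neg F) \<longleftrightarrow> \<not> sat X F"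
| "sat X (And F G) \<longleftrightarrow> sat X F \<and> sat X G"
| "sat X (Or F G) \<longleftrightarrow> sat X F \<or> sat X G"
| "sat X (Imp F G) \<longleftrightarrow> (sat X F \<longrightarrow> sat X G)"

primrec reduct :: "'a form \<Rightarrow> 'a set \<Rightarrow> 'a form" where
  "reduct (Atom a) X = (if sat X (Atom a) then Atom a else Bot)"
| "reduct Bot X = Bot"
| "reduct Top X = Top"
| "reduct (Neg F) X = (if sat X F then Bot else Top)"
| "reduct (And F G) X = (if sat X (And F G) then And (reduct F X) (reduct G X) else Bot)"
| "reduct (Or F G) X = (if sat X (Or F G) then Or (reduct F X) (reduct G X) else Bot)"
| "reduct (Imp F G) X = (if sat X (Imp F G) then Imp (reduct F X) (reduct G X) else Bot)"

definition stable_model :: "'a set \<Rightarrow> 'a form \<Rightarrow> 'a set \<Rightarrow> bool" where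
  "stable_model p F X \<longleftrightarrow> sat X F \<and> \<not> (\<exists>Y. Y \<subset> X \<and> X - Y \<subseteq> p \<and> sat Y (reduct F X))"

definition neg_s :: "real \<Rightarrow> real" where
  "neg_s x = 1 - x"

datatype fuzzy_binop = Conj_m | Disj_m | Impl_s

primrec binop_fun :: "fuzzy_binop \<Rightarrow> real \<Rightarrow> real \<Rightarrow> real" where
  "binop_fun Conj_m = (\<lambda>x y. min x y)"
| "binop_fun Disj_m = (\<lambda>x y. max x y)"
| "binop_fun Impl_s = (\<lambda>x y. max (1 - x) y)"

datatype 'a fform =
    FAtom 'a
  | FConst real
  | FNeg "'a fform"
  | FBin fuzzy_binop "'a fform" "'a fform"

text \<open>
  The datatype allows arbitrary real constants; the fuzzy formulas of a signature are those
  with constants in the unit interval. The lemmas below show that the translation and the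
  fuzzy reduct do not leave this class.
\<close>

primrec fform_of :: "'a set \<Rightarrow> 'a fform \<Rightarrow> bool" where
  "fform_of \<sigma> (FAtom a) \<longleftrightarrow> a \<in> \<sigma>"
| "fform_of \<sigma> (FConst c) \<longleftrightarrow> c \<in> {0..1}"
| "fform_of \<sigma> (FNeg F) \<longleftrightarrow> fform_of \<sigma> F"
| "fform_of \<sigma> (FBin b F G) \<longleftrightarrow> fform_of \<sigma> F \<and> fform_of \<sigma> G"

text \<open>
  Fuzzy interpretations of \<open>\<sigma>\<close> are extensional functions, so that two of them are equal
  iff they agree on \<open>\<sigma>\<close>.
\<close>

definition fuzzy_interps :: "'a set \<Rightarrow> ('a \<Rightarrow> real) set" where
  "fuzzy_interps \<sigma> = (\<sigma> \<rightarrow>\<^sub>E {0..1})"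

primrec fval :: "('a \<Rightarrow> real) \<Rightarrow> 'a fform \<Rightarrow> real" where
  "fval I (FAtom a) = I a"
| "fval I (FConst c) = c"
| "fval I (FNeg F) = neg_s (fval I F)"
| "fval I (FBin b F G) = binop_fun b (fval I F) (fval I G)"

definition fsat :: "('a \<Rightarrow> real) \<Rightarrow> 'a fform \<Rightarrow> bool" where
  "fsat I F \<longleftrightarrow> fval I F = 1"

primrec freduct :: "'a fform \<Rightarrow> ('a \<Rightarrow> real) \<Rightarrow> 'a fform" where
  "freduct (FAtom a) I = FAtom a"
| "freduct (FConst c) I = FConst c"
| "freduct (FNeg F) I = FConst (fval I (FNeg F))"
| "freduct (FBin b F G) I =
     FBin Conj_m (FBin b (freduct F I) (freduct G I)) (FConst (fval I (FBin b F G)))"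

definition fuzzy_less :: "'a set \<Rightarrow> 'a set \<Rightarrow> ('a \<Rightarrow> real) \<Rightarrow> ('a \<Rightarrow> real) \<Rightarrow> bool" where
  "fuzzy_less \<sigma> p J I \<longleftrightarrow> J \<noteq> I \<and> (\<forall>a\<in>\<sigma> - p. J a = I a) \<and> (\<forall>a\<in>p. J a \<le> I a)"

definition fuzzy_stable_model :: "'a set \<Rightarrow> 'a set \<Rightarrow> 'a fform \<Rightarrow> ('a \<Rightarrow> real) \<Rightarrow> bool" where
  "fuzzy_stable_model \<sigma> p F I \<longleftrightarrow>
     fsat I F \<and> \<not> (\<exists>J\<in>fuzzy_interps \<sigma>. fuzzy_less \<sigma> p J I \<and> fsat J (freduct F I))"

primrec fuzzy_form :: "'a form \<Rightarrow> 'a fform" where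
  "fuzzy_form (Atom a) = FAtom a"
| "fuzzy_form Bot = FConst 0"
| "fuzzy_form Top = FConst 1"
| "fuzzy_form (Neg F) = FNeg (fuzzy_form F)"
| "fuzzy_form (And F G) = FBin Conj_m (fuzzy_form F) (fuzzy_form G)"
| "fuzzy_form (Or F G) = FBin Disj_m (fuzzy_form F) (fuzzy_form G)"
| "fuzzy_form (Imp F G) = FBin Impl_s (fuzzy_form F) (fuzzy_form G)"

definition fuzzy_interp :: "'a set \<Rightarrow> 'a set \<Rightarrow> 'a \<Rightarrow> real" where
  "fuzzy_interp \<sigma> X = (\<lambda>a\<in>\<sigma>. if a \<in> X then 1 else 0)"

lemma fuzzy_interp_in_fuzzy_interps: "fuzzy_interp \<sigma> X \<in> fuzzy_interps \<sigma>"
  by (auto simp: fuzzy_interp_def fuzzy_interps_def)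

lemma fform_of_fuzzy_form: "fform_of \<sigma> (fuzzy_form F) \<longleftrightarrow> atoms F \<subseteq> \<sigma>"
  by (induction F) auto

lemma fval_in_unit_interval:
  assumes "I \<in> fuzzy_interps \<sigma>" "fform_of \<sigma> F"
  shows "fval I F \<in> {0..1}"
  using assms(2)
proof (induction F)
  case (FAtom a)
  then show ?case using assms(1) by (auto simp: fuzzy_interps_def dest: PiE_mem)
next
  case (FBin b F G)
  then show ?case by (cases b) auto
qed (auto simp: neg_s_def)

lemma fform_of_freduct:
  assumes "I \<in> fuzzy_interps \<sigma>" "fform_of \<sigma> F"
  shows "fform_of \<sigma> (freduct F I)"
  using assms(2)
proof (induction F)
  case (FNeg F)
  then show ?case using fval_in_unit_interval[OF assms(1), of "FNeg F"] by simp
next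
  case (FBin b F G)
  then show ?case using fval_in_unit_interval[OF assms(1), of "FBin b F G"] by simp
qed simp_all

end

theory Submission
  imports Defs
begin

text \<open>
  If \<open>J\<close> is a fuzzy interpretation below the crisp interpretation of \<open>X\<close>, round all its
  values smaller than 1 down to 0. This does not preserve all truth values of the reduct, but it
  preserves the extreme values 0 and 1, because \<open>min\<close>, \<open>max\<close> and \<open>max (1 - x) y\<close> attain an
  extreme value only on account of extreme arguments. Hence a fuzzy witness against stability
  yields a Boolean one; the converse holds since a Boolean interpretation is already crisp.
\<close>

lemma fval_fuzzy_form:
  assumes "atoms F \<subseteq> \<sigma>"
  shows "fval (fuzzy_interp \<sigma> X) (fuzzy_form F) = (if sat X F then 1 else 0)"
  using assms by (induction F) (auto simp: fuzzy_interp_def neg_s_def)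

text \<open>The \<open>min\<close> with the constant \<open>fval I (FBin b F G)\<close> does the job
  of replacing a falsified subformula by \<open>Bot\<close>. An atom false in \<open>X\<close>
  survives in the fuzzy reduct, but \<open>Y \<subseteq> X\<close> gives it the value 0.\<close>

lemma fval_freduct_crisp:
  assumes "atoms F \<subseteq> \<sigma>" and "Y \<subseteq> X"
  shows "fval (fuzzy_interp \<sigma> Y) (freduct (fuzzy_form F) (fuzzy_interp \<sigma> X)) =
    (if sat Y (reduct F X) then 1 else 0)"
  using assms
  by (induction F) (auto simp: fval_fuzzy_form neg_s_def, auto simp: fuzzy_interp_def)

text \<open>The two halves must be proved together, since an implication takes the value 1 if its
  antecedent has value 0. The bound on \<open>J\<close> keeps an atom outside \<open>X\<close> from
  reaching 1, matching the \<open>Bot\<close> in the Boolean reduct.\<close>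

lemma fval_freduct_extreme:
  assumes "atoms F \<subseteq> \<sigma>" and "J \<in> fuzzy_interps \<sigma>"
    and "\<And>a. a \<in> \<sigma> \<Longrightarrow> J a \<le> fuzzy_interp \<sigma> X a"
  defines "v \<equiv> fval J (freduct (fuzzy_form F) (fuzzy_interp \<sigma> X))"
  shows "(v = 1 \<longrightarrow> sat {a \<in> \<sigma>. J a = 1} (reduct F X)) \<and>
    (v = 0 \<longrightarrow> \<not> sat {a \<in> \<sigma>. J a = 1} (reduct F X))"
proof -
  \<comment> \<open>Only within the unit interval do extreme results of \<open>min\<close> and
    \<open>max\<close> force extreme arguments.\<close>
  have unit: "fval J (freduct (fuzzy_form G) (fuzzy_interp \<sigma> X)) \<in> {0..1}" if "atoms G \<subseteq> \<sigma>" for G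
    using that assms(2) fuzzy_interp_in_fuzzy_interps
    by (blast intro: fval_in_unit_interval fform_of_freduct fform_of_fuzzy_form[THEN iffD2])
  show ?thesis
    using assms(1) unfolding v_def
  proof (induction F)
    case (Atom a)
    then show ?case using assms(3)[of a] by (auto simp: fuzzy_interp_def)
  next
    case (Neg F)
    then show ?case by (simp add: fval_fuzzy_form neg_s_def)
  next
    case (And F G)
    then show ?case using unit[of F] unit[of G]
      by (auto simp: fval_fuzzy_form min_def split: if_splits)
  next
    case (Or F G)
    then show ?case using unit[of F] unit[of G]
      by (auto simp: fval_fuzzy_form min_def max_def split: if_splits)
  next
    case (Imp F G)
    then show ?case using unit[of F] unit[of G]
      by (auto simp: fval_fuzzy_form min_def max_def split: if_splits)
  qed simp_all
qed

theorem theorem3: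
  fixes \<sigma> p :: "'a set" and F :: "'a form" and I :: "'a set"
  assumes "p \<subseteq> \<sigma>" and "atoms F \<subseteq> \<sigma>" and "I \<subseteq> \<sigma>"
  shows "stable_model p F I \<longleftrightarrow>
    fuzzy_stable_model \<sigma> p (fuzzy_form F) (fuzzy_interp \<sigma> I)"
proof -
  let ?I = "fuzzy_interp \<sigma> I"
  \<comment> \<open>Satisfaction of the formula itself transfers by \<open>fval_fuzzy_form\<close>,
    so it remains to match the witnesses against stability.\<close>
  have "(\<exists>Y. Y \<subset> I \<and> I - Y \<subseteq> p \<and> sat Y (reduct F I)) \<longleftrightarrow>
    (\<exists>J\<in>fuzzy_interps \<sigma>. fuzzy_less \<sigma> p J ?I \<and> fsat J (freduct (fuzzy_form F) ?I))"
    (is "?boolean \<longleftrightarrow> ?fuzzy")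
  proof
    assume ?boolean
    then obtain Y where Y: "Y \<subset> I" "I - Y \<subseteq> p" "sat Y (reduct F I)" by blast
    obtain a where a: "a \<in> I" "a \<notin> Y" using Y(1) by blast
    then have "fuzzy_interp \<sigma> Y a \<noteq> ?I a" using assms(3) by (auto simp: fuzzy_interp_def)
    then have "fuzzy_interp \<sigma> Y \<noteq> ?I" by metis
    moreover have "\<forall>a\<in>\<sigma> - p. fuzzy_interp \<sigma> Y a = ?I a" "\<forall>a\<in>p. fuzzy_interp \<sigma> Y a \<le> ?I a"
      using Y(1,2) by (auto simp: fuzzy_interp_def)
    ultimately have "fuzzy_less \<sigma> p (fuzzy_interp \<sigma> Y) ?I"
      by (simp add: fuzzy_less_def)
    moreover have "fsat (fuzzy_interp \<sigma> Y) (freduct (fuzzy_form F) ?I)"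
      using Y assms(2) by (simp add: fsat_def fval_freduct_crisp)
    ultimately show ?fuzzy using fuzzy_interp_in_fuzzy_interps by blast
  next
    assume ?fuzzy
    then obtain J where J: "J \<in> fuzzy_interps \<sigma>" "fuzzy_less \<sigma> p J ?I"
      "fsat J (freduct (fuzzy_form F) ?I)" by blast
    have le: "J a \<le> ?I a" if "a \<in> \<sigma>" for a
      using J(2) that by (cases "a \<in> p") (auto simp: fuzzy_less_def)
    have nonneg: "0 \<le> J a" if "a \<in> \<sigma>" for a
      using J(1) that by (auto simp: fuzzy_interps_def dest: PiE_mem)
    define Y where "Y = {a \<in> \<sigma>. J a = 1}"
    have "Y \<subseteq> I"
    proof
      fix a assume "a \<in> Y"
      then show "a \<in> I" using le[of a] by (auto simp: Y_def fuzzy_interp_def split: if_splits)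
    qed
    \<comment> \<open>If \<open>Y = I\<close>, then \<open>J\<close> is 1 on \<open>I\<close>, while
      \<open>le\<close> and \<open>nonneg\<close> force it to 0 on the rest of
      \<open>\<sigma>\<close>.\<close>
    moreover have "Y \<noteq> I"
    proof
      assume "Y = I"
      have "J = ?I"
      proof (rule PiE_ext)
        show "J \<in> \<sigma> \<rightarrow>\<^sub>E {0..1}" using J(1) by (simp add: fuzzy_interps_def)
        show "?I \<in> \<sigma> \<rightarrow>\<^sub>E {0..1}"
          using fuzzy_interp_in_fuzzy_interps[of \<sigma> I] by (simp add: fuzzy_interps_def)
        show "J a = ?I a" if "a \<in> \<sigma>" for a
          using that le[of a] nonneg[of a] \<open>Y = I\<close> by (auto simp: Y_def fuzzy_interp_def)
      qed
      then show False using J(2) by (simp add: fuzzy_less_def)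
    qed
    \<comment> \<open>Off \<open>p\<close>, \<open>J\<close> agrees with \<open>?I\<close>, which is
      1 on \<open>I\<close>.\<close>
    moreover have "I - Y \<subseteq> p"
      using J(2) assms(3) by (auto simp: Y_def fuzzy_less_def fuzzy_interp_def)
    moreover have "sat Y (reduct F I)"
      using fval_freduct_extreme[OF assms(2) J(1) le] J(3) by (simp add: Y_def fsat_def)
    ultimately show ?boolean by blast
  qed
  then show ?thesis
    using assms(2) by (simp add: stable_model_def fuzzy_stable_model_def fsat_def fval_fuzzy_form)
qed

end
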